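(* Let $q$ be a power of $2$ such that $q-1$ is squarefree, and let $m \ge 2$. Suppose that for every partition $\lambda$ of $m$, every element of $\mathbb{F}_q^\times$ is the discriminant of the same number of polynomials in $S_{\lambda,\mathbb{F}_q}$. Then $\gcd(q-1, m(m-1)) = 1$.
   Context: For a partition $\lambda = (\lambda_1,\dots,\lambda_k)$ of $m$, a monic $f \in \mathbb{F}_q[x]$ of degree $m$ has factorization type $\lambda$ if $f = \pi_1\cdots\pi_k$ with the $\pi_i$ distinct monic irreducible polynomials and $\deg \pi_i = \lambda_i$. $S_{\lambda,\mathbb{F}_q}$ is the set of monic squarefree polynomials in $\mathbb{F}_q[x]$ of factorization type $\lambda$. For $f$ of degree $m\ge 2$ with leading coefficient $a_m$ and roots $\alpha_i$ in a splitting field, $\operatorname{disc}(f) = a_m^{2m-2}\prod_{i<j}(\alpha_i-\alpha_j)^2$. *)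

theory Defs
  imports "HOL-Algebra.Algebraic_Closure_Type" "HOL-Library.Multiset"
begin

definition is_partition :: "nat multiset \<Rightarrow> nat \<Rightarrow> bool" where
  "is_partition lam m \<longleftrightarrow> (\<forall>k\<in>#lam. 0 < k) \<and> sum_mset lam = m"

definition S_fact_type :: "nat multiset \<Rightarrow> ('a::field) poly set" where
  "S_fact_type lam = {f. lead_coeff f = 1 \<and> (\<exists>P. finite P \<and> (\<forall>p\<in>P. lead_coeff p = 1 \<and> irreducible p)
       \<and> f = \<Prod>P \<and> image_mset degree (mset_set P) = lam)}"

definition disc :: "('a::field) poly \<Rightarrow> 'a" where
  "disc f = (let m = degree f;
                 rs = (SOME xs. mset xs = proots (map_poly to_ac f))
             in of_ac (to_ac (lead_coeff f) ^ (2*m - 2) *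
                  (\<Prod>i<m. \<Prod>j\<in>{i<..<m}. (rs!i - rs!j)^2)))"

end

theory Submission
  imports Defs
begin

text \<open>
  Over a finite field every squarefree polynomial has a nonzero discriminant, so equidistribution
  forces \<open>q - 1\<close> to divide the number of polynomials of each factorization type. Let a prime \<open>p\<close> divide
  both \<open>q - 1\<close> and \<open>m * (m - 1)\<close>; then \<open>p\<close> is odd and, as \<open>q - 1\<close> is squarefree, \<open>p ^ 2\<close> does not divide
  \<open>q - 1\<close>. The number of monic irreducible polynomials of degree \<open>p * 2 ^ s\<close> is then prime to \<open>p\<close>, by
  Gauss's formula modulo \<open>p ^ 2\<close>. Write \<open>m = p * n + e\<close> with \<open>e\<close> equal to 0 or 1, and let the parts be
  \<open>p * 2 ^ i\<close> for the positions \<open>i\<close> of the ones in the binary expansion of \<open>n\<close>, with \<open>e\<close> parts equal to 1. These parts are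
  distinct, so the polynomials of this type are counted by a product of numbers prime to \<open>p\<close>, which
  is therefore not divisible by \<open>q - 1\<close>.
\<close>

section \<open>Discriminants of squarefree polynomials\<close>

lemma power_card_UNIV_eq_same:
  fixes x :: "'a :: {finite, field}"
  shows "x ^ card (UNIV :: 'a set) = x"
proof (cases "x = 0")
  case False
  have *: "Suc (card (UNIV :: 'a set) - 1) = card (UNIV :: 'a set)"
    using finite_UNIV_card_ge_0[where ?'a = 'a] by simp
  have "x * (\<Prod>y\<in>UNIV-{0}. x * y) = x * x ^ (card (UNIV :: 'a set) - 1) * \<Prod>(UNIV-{0})"
    by (simp add: prod.distrib mult_ac)
  also have "x * x ^ (card (UNIV :: 'a set) - 1) = x ^ card (UNIV :: 'a set)"
    by (metis * power_Suc)
  \<comment> \<open>Multiplication by the nonzero \<open>x\<close> permutes the nonzero elements, so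
    their product can be cancelled afterwards.\<close>
  also have "(\<Prod>y\<in>UNIV-{0}. x * y) = (\<Prod>y\<in>UNIV-{0}. y)"
    by (rule prod.reindex_bij_witness[of _ "\<lambda>y. y / x" "\<lambda>y. x * y"]) (use False in auto)
  finally show ?thesis
    by simp
qed (use finite_UNIV_card_ge_0[where ?'a = 'a] in auto)

lemma prime_CHAR_finite_field: "prime CHAR('a :: {finite, field})"
  by (rule prime_CHAR_semidom, rule finite_imp_CHAR_pos) simp

text \<open>Translation by 1 permutes the field, so it leaves the sum of all elements unchanged; yet
  it adds 1 once per element.\<close>

lemma CHAR_dvd_card_UNIV: "CHAR('a :: {finite, field}) dvd card (UNIV :: 'a set)"
proof -
  have "(\<Sum>x\<in>(UNIV :: 'a set). x) = (\<Sum>x\<in>UNIV. x + 1)"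
    by (rule sum.reindex_bij_witness[of _ "\<lambda>x. x + 1" "\<lambda>x. x - 1"]) auto
  hence "of_nat (card (UNIV :: 'a set)) = (0 :: 'a)"
    by (simp add: sum.distrib)
  thus ?thesis
    by (simp add: of_nat_eq_0_iff_char_dvd)
qed

lemma freshmans_dream_diff:
  fixes x y :: "'a :: comm_ring_1"
  assumes "prime CHAR('a)" "m = CHAR('a) ^ n"
  shows "(x - y) ^ m = x ^ m - y ^ m"
  using freshmans_dream'[OF assms, of "x - y" y] by (simp add: algebra_simps)

text \<open>The Frobenius map is additive with trivial kernel, hence injective, hence surjective on
  a finite set.\<close>

lemma pth_root_exists_finite_field:
  fixes x :: "'a :: {finite, field}"
  shows "\<exists>y. y ^ CHAR('a) = x"
proof -
  let ?p = "CHAR('a)"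
  have "inj (\<lambda>y :: 'a. y ^ ?p)"
  proof (rule injI)
    fix y z :: 'a
    assume *: "y ^ ?p = z ^ ?p"
    with freshmans_dream_diff[OF prime_CHAR_finite_field, of ?p 1 y z] show "y = z"
      by simp
  qed
  hence "surj (\<lambda>y :: 'a. y ^ ?p)"
    by (simp add: finite_UNIV_inj_surj)
  thus ?thesis
    by (metis surjD)
qed

text \<open>If the derivative vanished, only exponents divisible by the characteristic would occur
  in \<open>f\<close>. As every coefficient has a root of that order, \<open>f\<close> would be a
  proper power and not irreducible.\<close>

lemma irreducible_imp_pderiv_nonzero:
  fixes f :: "'a :: {finite, field} poly"
  assumes "irreducible f"
  shows "pderiv f \<noteq> 0"
proof
  assume f': "pderiv f = 0"
  let ?p = "CHAR('a)"
  have p: "prime ?p"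
    by (rule prime_CHAR_finite_field)
  hence p1: "?p > 1"
    by (rule prime_gt_1_nat)
  have c: "coeff f j = 0" if "\<not> ?p dvd j" for j
  proof -
    have "j \<noteq> 0"
      using that by (metis dvd_0_right)
    then obtain i where [simp]: "j = Suc i"
      using not0_implies_Suc by blast
    have "of_nat (Suc i) * coeff f (Suc i) = 0"
      using f' by (metis coeff_0 coeff_pderiv)
    thus ?thesis
      using that by (auto simp: of_nat_eq_0_iff_char_dvd simp del: of_nat_Suc)
  qed
  define r where "r = (\<lambda>x :: 'a. SOME y. y ^ ?p = x)"
  have r: "r x ^ ?p = x" for x
    unfolding r_def by (rule someI_ex, rule pth_root_exists_finite_field)
  \<comment> \<open>The candidate root of \<open>f\<close> takes roots of the coefficients at
    multiples of \<open>?p\<close>. The range up to \<open>degree f\<close> is longer than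
    necessary; the excess terms are zero.\<close>
  define h where "h = (\<Sum>i\<le>degree f. monom (r (coeff f (?p * i))) i)"
  have "h ^ ?p = (\<Sum>i\<le>degree f. monom (r (coeff f (?p * i))) i ^ ?p)"
    unfolding h_def by (rule freshmans_dream_sum) (use p in auto)
  also have "\<dots> = (\<Sum>i\<le>degree f. monom (coeff f (?p * i)) (?p * i))"
    by (simp add: monom_power r mult.commute)
  also have "\<dots> = f"
  proof (rule poly_eqI)
    fix n
    have "coeff (\<Sum>i\<le>degree f. monom (coeff f (?p * i)) (?p * i)) n
        = (\<Sum>i\<le>degree f. if ?p * i = n then coeff f n else 0)"
      by (auto simp: coeff_sum intro!: sum.cong)
    also have "\<dots> = coeff f n"
    proof (cases "?p dvd n \<and> n \<le> degree f")
      case True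
      then obtain i where i: "n = ?p * i"
        by auto
      have "(?p * j = n) = (j = i)" for j
        using p1 i by auto
      moreover have "i \<le> degree f"
        using True i p1 mult_le_mono1[of 1 ?p i] by linarith
      ultimately show ?thesis
        by (simp add: sum.delta)
    next
      case False
      hence "coeff f n = 0"
        using c[of n] coeff_eq_0[of f n] not_le by blast
      thus ?thesis
        by (intro trans[OF sum.neutral]) auto
    qed
    finally show "coeff (\<Sum>i\<le>degree f. monom (coeff f (?p * i)) (?p * i)) n = coeff f n" .
  qed
  finally have hf: "f = h * h ^ (?p - 1)"
    using p1 by (metis power_Suc Suc_diff_1 order.strict_trans zero_less_one)
  \<comment> \<open>Whichever factor is a unit, \<open>h\<close> itself is one, and then so is
    \<open>f\<close>.\<close>
  have "h dvd 1 \<or> h ^ (?p - 1) dvd 1"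
    using irreducibleD[OF assms hf] .
  hence "h dvd 1"
    using p1 by (auto simp: is_unit_power_iff)
  hence "f dvd 1"
    by (subst hf) (auto simp: is_unit_power_iff)
  with assms show False
    by (simp add: irreducible_not_unit)
qed

section \<open>Irreducible polynomials and their roots in the algebraic closure\<close>

lemma monic_irreducible_dvd_imp_eq:
  fixes p q :: "'a :: field poly"
  assumes "irreducible p" "irreducible q" "lead_coeff p = 1" "lead_coeff q = 1" "p dvd q"
  shows "p = q"
proof -
  obtain r where r: "q = p * r"
    using assms(5) by auto
  hence "is_unit r"
    using assms irreducibleD[OF assms(2) r] irreducible_not_unit by blast
  then obtain c where c: "r = [:c:]"
    by (auto elim: is_unit_polyE)
  have "c = 1"
    using assms(3,4) r c by (simp split: if_splits)
  with r c show ?thesis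
    by simp
qed

lemma prime_elem_dvd_prodD:
  assumes "prime_elem p" "finite A" "p dvd prod f A"
  shows "\<exists>a\<in>A. p dvd f a"
  using assms(2,3,1)
  by (induction A rule: finite_induct) (auto simp: prime_elem_dvd_mult_iff prime_elem_not_unit)

lemma map_poly_to_ac_add: "map_poly to_ac (p + q) = map_poly to_ac p + map_poly to_ac q"
  by (rule poly_eqI) (simp add: coeff_map_poly)

lemma map_poly_to_ac_mult: "map_poly to_ac (p * q) = map_poly to_ac p * map_poly to_ac q"
  by (rule poly_eqI) (simp add: coeff_map_poly coeff_mult to_ac_sum)

lemma pderiv_map_poly_to_ac: "pderiv (map_poly to_ac p) = map_poly to_ac (pderiv p)"
  by (rule poly_eqI) (simp add: coeff_map_poly coeff_pderiv)

lemma degree_map_poly_to_ac [simp]: "degree (map_poly to_ac p) = degree p"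
  by (rule degree_map_poly) simp

lemma map_poly_to_ac_eq_0_iff [simp]: "map_poly to_ac p = 0 \<longleftrightarrow> p = 0"
  by (auto simp: poly_eq_iff coeff_map_poly)

text \<open>A polynomial \<open>g\<close> of least degree vanishing at \<open>x\<close> divides
  every polynomial vanishing at \<open>x\<close>. It divides the irreducible \<open>p\<close>
  without being a unit, so \<open>p\<close> in turn divides \<open>g\<close>, which divides
  \<open>q\<close>.\<close>

lemma irreducible_dvd_if_common_root:
  fixes p q :: "'a :: field poly"
  assumes p: "irreducible p"
    and xp: "poly (map_poly to_ac p) x = 0" and xq: "poly (map_poly to_ac q) x = 0"
  shows "p dvd q"
proof -
  let ?ev = "\<lambda>g. poly (map_poly to_ac g) x"
  let ?P = "\<lambda>n. \<exists>g. g \<noteq> 0 \<and> ?ev g = 0 \<and> degree g = n"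
  have ex: "?P (degree p)"
    using p xp by (metis irreducible_def)
  define n where "n = (LEAST n. ?P n)"
  have "?P n"
    unfolding n_def using ex by (rule LeastI)
  then obtain g where g: "g \<noteq> 0" "?ev g = 0" "degree g = n"
    by blast
  have min: "n \<le> degree h" if "h \<noteq> 0" "?ev h = 0" for h
    unfolding n_def by (rule Least_le) (use that in blast)
  have dvd: "g dvd h" if "?ev h = 0" for h
  proof -
    have "?ev h = ?ev (h div g * g + h mod g)"
      by simp
    also have "\<dots> = ?ev (h mod g)"
      by (simp only: map_poly_to_ac_add map_poly_to_ac_mult poly_add poly_mult g) simp
    finally have "?ev (h mod g) = 0"
      using that by simp
    hence "h mod g = 0"
      using min[of "h mod g"] degree_mod_less[of g h] g by linarith
    thus ?thesis
      by (simp add: mod_eq_0_iff_dvd)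
  qed
  have "\<not> is_unit g"
  proof
    assume "is_unit g"
    then obtain c where "g = [:c:]"
      using g(1) by (metis is_unit_iff_degree degree_eq_zeroE)
    with g show False
      by (simp add: map_poly_pCons)
  qed
  hence "p dvd g"
    using dvd[OF xp] p by (metis irreducible_altdef)
  with dvd[OF xq] show ?thesis
    by (rule dvd_trans[rotated])
qed

text \<open>The root \<open>x\<close> belongs to one factor \<open>p\<close>, and with the product
  of the others called \<open>g\<close> the derivative at \<open>x\<close> is
  \<open>p'(x) * g(x)\<close>. Otherwise \<open>p\<close> would divide its nonzero derivative, which
  has smaller degree, or another monic irreducible factor.\<close>

lemma squarefree_product_no_multiple_root:
  fixes P :: "'a :: {finite, field} poly set"
  assumes P: "finite P" "\<And>p. p \<in> P \<Longrightarrow> lead_coeff p = 1 \<and> irreducible p"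
    and x: "poly (map_poly to_ac (\<Prod>P)) x = 0"
  shows "poly (pderiv (map_poly to_ac (\<Prod>P))) x \<noteq> 0"
proof -
  have "poly (map_poly to_ac (\<Prod>A)) x = 0 \<Longrightarrow> finite A \<Longrightarrow> \<exists>p\<in>A. poly (map_poly to_ac p) x = 0"
    for A :: "'a poly set"
    by (induction A rule: infinite_finite_induct)
       (auto simp: map_poly_to_ac_mult)
  then obtain p where p: "p \<in> P" "poly (map_poly to_ac p) x = 0"
    using P x by blast
  have pi: "irreducible p" "lead_coeff p = 1"
    using P p by auto
  define g where "g = \<Prod>(P - {p})"
  have f: "\<Prod>P = p * g"
    unfolding g_def using P p by (simp add: prod.remove)
  have "poly (map_poly to_ac (pderiv p)) x \<noteq> 0"
  proof
    assume "poly (map_poly to_ac (pderiv p)) x = 0"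
    hence "p dvd pderiv p"
      using irreducible_dvd_if_common_root pi(1) p(2) by blast
    hence *: "degree p \<le> degree (pderiv p)"
      using irreducible_imp_pderiv_nonzero[OF pi(1)] dvd_imp_degree_le by blast
    have "degree p \<noteq> 0"
      using pi(1) by (metis irreducible_def is_unit_iff_degree)
    moreover have "degree (pderiv p) \<le> degree p - 1"
      by (rule degree_le) (auto simp: coeff_pderiv coeff_eq_0)
    ultimately show False
      using * by simp
  qed
  moreover have "poly (map_poly to_ac g) x \<noteq> 0"
  proof
    assume "poly (map_poly to_ac g) x = 0"
    hence "p dvd g"
      using irreducible_dvd_if_common_root pi(1) p(2) by blast
    then obtain r where "r \<in> P - {p}" "p dvd r"
      unfolding g_def using prime_elem_dvd_prodD[OF field_poly_irreducible_imp_prime[OF pi(1)], of "P - {p}" "\<lambda>r. r"] P(1)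
      by blast
    thus False
      using monic_irreducible_dvd_imp_eq[of p r] P pi by auto
  qed
  ultimately show ?thesis
    using p(2) unfolding f
    by (simp add: pderiv_map_poly_to_ac pderiv_mult map_poly_to_ac_mult map_poly_to_ac_add)
qed

section \<open>Simple roots and the discriminant as an element of the base field\<close>

lemma order_le_1_if_simple:
  fixes f :: "'a :: field poly"
  assumes "f \<noteq> 0" "poly f x = 0 \<Longrightarrow> poly (pderiv f) x \<noteq> 0"
  shows "order x f \<le> 1"
proof (rule ccontr)
  assume "\<not> order x f \<le> 1"
  hence "[:-x, 1:] ^ 2 dvd f"
    by (intro dvd_trans[OF le_imp_power_dvd order_1]) simp
  then obtain g where g: "f = [:-x, 1:] * ([:-x, 1:] * g)"
    unfolding power2_eq_square dvd_def mult.assoc by blast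
  have "poly f x = 0"
    unfolding g by (simp only: poly_mult) simp
  moreover have "poly (pderiv f) x = 0"
    unfolding g by (simp only: pderiv_mult poly_mult poly_add) simp
  ultimately show False
    using assms by blast
qed

lemma size_proots_alg_closed:
  fixes p :: "'a :: alg_closed_field poly"
  shows "size (proots p) = degree p"
proof (cases "p = 0")
  case False
  obtain B where B: "size B = degree p" "p = smult (lead_coeff p) (\<Prod>x\<in>#B. [:-x, 1:])"
    using alg_closed_imp_factorization[OF False] by blast
  have "proots (\<Prod>x\<in>#B. [:-x, 1:]) = B" for B :: "'a multiset"
  proof (induction B)
    case (add x B)
    have "(\<Prod>x\<in>#B. [:-x, 1:]) \<noteq> (0 :: 'a poly)"
      by (auto simp: prod_mset_zero_iff)
    thus ?case
      using add by (simp add: proots_mult del: mult_pCons_left)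
  qed simp
  hence "proots p = B"
    by (subst B(2)) (use False in simp)
  thus ?thesis
    using B by simp
qed simp

text \<open>The \<open>q\<close> elements of the base field are roots of \<open>X ^ q - X\<close>,
  which has at most \<open>q\<close> roots. This is the criterion by which the discriminant is
  recognised as an element of the base field.\<close>

lemma range_to_ac_eq_Frobenius_fixed:
  "range (to_ac :: 'a :: {finite, field} \<Rightarrow> _) = {x. x ^ card (UNIV :: 'a set) = x}"
proof (rule card_seteq)
  let ?q = "card (UNIV :: 'a set)"
  have q: "?q > 1"
    using card_mono[of "UNIV :: 'a set" "{0, 1}"] by simp
  let ?f = "monom 1 ?q - [:0, 1:] :: 'a alg_closure poly"
  have d: "degree ?f \<le> ?q"
    by (rule degree_diff_le) (use q in \<open>auto simp: degree_monom_eq\<close>)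
  have "coeff ?f ?q = 1"
    using q by (auto simp: coeff_pCons split: nat.splits)
  hence f0: "?f \<noteq> 0"
    by (metis coeff_0 zero_neq_one)
  have eq: "{x. x ^ ?q = x} = {x. poly ?f x = 0}"
    by (simp add: poly_monom)
  show "finite {x :: 'a alg_closure. x ^ ?q = x}"
    unfolding eq by (rule poly_roots_finite[OF f0])
  have "card {x :: 'a alg_closure. x ^ ?q = x} \<le> ?q"
    unfolding eq using card_poly_roots_bound[OF f0] d by simp
  also have "?q = card (range (to_ac :: 'a \<Rightarrow> _))"
    by (simp add: card_image inj_to_ac)
  finally show "card {x :: 'a alg_closure. x ^ ?q = x} \<le> card (range (to_ac :: 'a \<Rightarrow> _))" .
  show "range (to_ac :: 'a \<Rightarrow> _) \<subseteq> {x. x ^ ?q = x}"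
    by (auto simp: power_card_UNIV_eq_same simp flip: to_ac_power)
qed

lemma prod_off_diagonal:
  fixes g :: "nat \<Rightarrow> nat \<Rightarrow> 'a :: comm_monoid_mult"
  shows "(\<Prod>i<m. \<Prod>j\<in>{..<m} - {i}. g i j) = (\<Prod>i<m. \<Prod>j\<in>{i<..<m}. g i j * g j i)"
proof -
  have "(\<Prod>i<m. \<Prod>j\<in>{..<m} - {i}. g i j)
      = (\<Prod>i<m. (\<Prod>j\<in>{i<..<m}. g i j) * (\<Prod>j\<in>{..<i}. g i j))"
    by (intro prod.cong refl, subst prod.union_disjoint [symmetric]) (auto intro!: prod.cong)
  also have "\<dots> = (\<Prod>i<m. \<Prod>j\<in>{i<..<m}. g i j) * (\<Prod>i<m. \<Prod>j\<in>{..<i}. g i j)"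
    by (rule prod.distrib)
  also have "(\<Prod>i<m. \<Prod>j\<in>{..<i}. g i j) = (\<Prod>(i, j)\<in>(SIGMA i:{..<m}. {..<i}). g i j)"
    by (rule prod.Sigma) auto
  also have "\<dots> = (\<Prod>(j, i)\<in>(SIGMA j:{..<m}. {j<..<m}). g i j)"
    by (rule prod.reindex_bij_witness[of _ prod.swap prod.swap]) auto
  also have "\<dots> = (\<Prod>j<m. \<Prod>i\<in>{j<..<m}. g i j)"
    by (rule prod.Sigma [symmetric]) auto
  finally show ?thesis
    by (simp add: prod.distrib)
qed

text \<open>The product \<open>D\<close> over the roots is nonzero because the roots are simple.
  Since \<open>of_ac\<close> inverts \<open>to_ac\<close> only on its range, \<open>D\<close> must
  also be shown to lie in the base field: it is fixed by the Frobenius map, which permutes the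
  roots.\<close>

lemma disc_nonzero_if_squarefree:
  fixes f :: "'a :: {finite, field} poly"
  assumes q: "card (UNIV :: 'a set) = 2 ^ k" and f: "f \<in> S_fact_type lam"
  shows "disc f \<noteq> 0"
proof -
  have CH: "CHAR('a) = 2"
    using prime_CHAR_finite_field[where ?'a = 'a] CHAR_dvd_card_UNIV[where ?'a = 'a] q
    by (metis prime_dvd_power primes_dvd_imp_eq two_is_prime_nat)
  obtain P where P: "finite P" "\<And>p. p \<in> P \<Longrightarrow> lead_coeff p = 1 \<and> irreducible p" "f = \<Prod>P"
    and lf: "lead_coeff f = 1"
    using f unfolding S_fact_type_def by blast
  define F where "F = map_poly to_ac f"
  have f0: "f \<noteq> 0"
    using lf by auto
  hence F0: "F \<noteq> 0"
    by (simp add: F_def)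
  define m where "m = degree f"
  \<comment> \<open>The enumeration of the roots is an arbitrary choice, so only its multiset is
    known.\<close>
  define rs where "rs = (SOME xs. mset xs = proots F)"
  have "\<exists>xs. mset xs = proots F"
    by (rule ex_mset)
  hence rs: "mset rs = proots F"
    unfolding rs_def by (rule someI_ex)
  have "count (mset rs) x \<le> 1" for x
    using order_le_1_if_simple[OF F0, of x] squarefree_product_no_multiple_root[OF P(1,2), of x] F0
    by (simp add: rs F_def P(3))
  hence dist: "distinct rs"
    by (auto simp: distinct_count_atmost_1 le_Suc_eq split: if_splits)
  have len: "length rs = m"
    using size_proots_alg_closed[of F] arg_cong[OF rs, of size] by (simp add: F_def m_def)
  have set_rs: "set rs = {x. poly F x = 0}"
    using F0 rs by (metis set_count_proots set_mset_mset)
  define D where "D = (\<Prod>i<m. \<Prod>j\<in>{i<..<m}. (rs!i - rs!j)^2)"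
  have disc: "disc f = of_ac D"
    by (simp add: disc_def Let_def D_def lf[folded m_def] F_def [symmetric] rs_def [symmetric] m_def [symmetric])
  have D0: "D \<noteq> 0"
    using dist len by (auto simp: D_def nth_eq_iff_index_eq)
  \<comment> \<open>In characteristic 2 the square of a difference is the product over both
    orderings of the pair, so \<open>D\<close> becomes a product over ordered pairs of roots,
    independent of the enumeration.\<close>
  have neg: "x - y = y - x" for x y :: "'a alg_closure"
    by (metis CH CHAR_alg_closure minus_diff_eq uminus_CHAR_2)
  have "D = (\<Prod>i<m. \<Prod>j\<in>{i<..<m}. (rs!i - rs!j) * (rs!j - rs!i))"
    unfolding D_def power2_eq_square by (intro prod.cong refl arg_cong2[where f = "(*)"] neg)
  also have "\<dots> = (\<Prod>i<m. \<Prod>j\<in>{..<m} - {i}. rs!i - rs!j)"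
    by (rule prod_off_diagonal [symmetric])
  also have "\<dots> = (\<Prod>i<m. \<Prod>b\<in>set rs - {rs!i}. rs!i - b)"
  proof (rule prod.cong[OF refl])
    fix i assume "i \<in> {..<m}"
    hence "bij_betw ((!) rs) ({..<m} - {i}) (set rs - {rs!i})"
      using bij_betw_nth[OF dist refl refl] len
      by (intro bij_betw_DiffI) auto
    from prod.reindex_bij_betw[OF this, of "\<lambda>b. rs!i - b"]
    show "(\<Prod>j\<in>{..<m} - {i}. rs!i - rs!j) = (\<Prod>b\<in>set rs - {rs!i}. rs!i - b)" .
  qed
  also have "\<dots> = (\<Prod>a\<in>set rs. \<Prod>b\<in>set rs - {a}. a - b)"
    using bij_betw_nth[OF dist refl refl] len
    by (intro prod.reindex_bij_betw[of "(!) rs" _ _ "\<lambda>a. \<Prod>b\<in>set rs - {a}. a - b"]) auto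
  finally have D: "D = (\<Prod>a\<in>set rs. \<Prod>b\<in>set rs - {a}. a - b)" .
  define \<phi> where "\<phi> = (\<lambda>x :: 'a alg_closure. x ^ card (UNIV :: 'a set))"
  have CH': "prime CHAR('a alg_closure)" "card (UNIV :: 'a set) = CHAR('a alg_closure) ^ k"
    using CH q by auto
  have \<phi>_diff: "\<phi> (x - y) = \<phi> x - \<phi> y" for x y
    unfolding \<phi>_def by (rule freshmans_dream_diff[OF CH'])
  have \<phi>_inj: "inj \<phi>"
  proof (rule injI)
    fix x y assume "\<phi> x = \<phi> y"
    hence "\<phi> (x - y) = 0"
      by (simp add: \<phi>_diff)
    thus "x = y"
      by (simp add: \<phi>_def)
  qed
  \<comment> \<open>Since \<open>\<phi>\<close> is additive and multiplicative and fixes the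
    coefficients of \<open>F\<close>, it maps roots to roots; being injective, it permutes the
    finite root set.\<close>
  have \<phi>_root: "poly F (\<phi> x) = \<phi> (poly F x)" for x
  proof -
    have "\<phi> (poly F x) = (\<Sum>i\<le>degree f. \<phi> (to_ac (coeff f i) * x ^ i))"
      unfolding \<phi>_def poly_altdef by (subst freshmans_dream_sum'[OF CH']) (simp add: F_def coeff_map_poly)
    also have "\<dots> = poly F (\<phi> x)"
      unfolding \<phi>_def poly_altdef
      by (simp add: F_def coeff_map_poly power_mult_distrib power_card_UNIV_eq_same mult.commute
            flip: to_ac_power power_mult)
    finally show ?thesis ..
  qed
  have "\<phi> ` set rs \<subseteq> set rs"
    by (auto simp: set_rs \<phi>_root) (simp add: \<phi>_def finite_UNIV_card_ge_0)
  hence "\<phi> ` set rs = set rs"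
    by (intro endo_inj_surj inj_on_subset[OF \<phi>_inj]) auto
  hence bij: "bij_betw \<phi> (set rs) (set rs)"
    using inj_on_subset[OF \<phi>_inj] by (simp add: bij_betw_def)
  have "\<phi> D = (\<Prod>a\<in>set rs. \<Prod>b\<in>set rs - {a}. \<phi> a - \<phi> b)"
    unfolding D by (simp add: \<phi>_diff [symmetric]) (simp add: \<phi>_def flip: prod_power_distrib)
  also have "\<dots> = (\<Prod>a\<in>set rs. \<Prod>b\<in>set rs - {\<phi> a}. \<phi> a - b)"
  proof (rule prod.cong[OF refl])
    fix a assume "a \<in> set rs"
    hence "bij_betw \<phi> (set rs - {a}) (set rs - {\<phi> a})"
      using bij by (intro bij_betw_DiffI) (auto simp: bij_betw_def)
    from prod.reindex_bij_betw[OF this, of "\<lambda>b. \<phi> a - b"]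
    show "(\<Prod>b\<in>set rs - {a}. \<phi> a - \<phi> b) = (\<Prod>b\<in>set rs - {\<phi> a}. \<phi> a - b)" .
  qed
  also have "\<dots> = D"
    unfolding D by (rule prod.reindex_bij_betw[OF bij])
  finally have "D \<in> range (to_ac :: 'a \<Rightarrow> _)"
    unfolding range_to_ac_eq_Frobenius_fixed \<phi>_def by simp
  then obtain d :: 'a where "D = to_ac d"
    by auto
  thus ?thesis
    using D0 disc by simp
qed

section \<open>Counting irreducible polynomials\<close>

definition monics :: "nat \<Rightarrow> 'a :: field poly set" where
  "monics n = {f. lead_coeff f = 1 \<and> degree f = n}"

definition monic_irreducibles :: "nat \<Rightarrow> 'a :: field poly set" where
  "monic_irreducibles n = {f. lead_coeff f = 1 \<and> irreducible f \<and> degree f = n}"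

lemma monics_0: "monics 0 = {1}"
  by (auto simp: monics_def elim!: degree_eq_zeroE)

lemma monics_Suc: "monics (Suc n) = (\<lambda>(c, f). pCons c f) ` (UNIV \<times> monics n)"
proof safe
  fix f :: "'a poly"
  assume f: "f \<in> monics (Suc n)"
  obtain c g where g: "f = pCons c g"
    by (rule pCons_cases)
  have "g \<noteq> 0"
    using f g by (auto simp: monics_def)
  hence "g \<in> monics n"
    using f g by (auto simp: monics_def)
  thus "f \<in> (\<lambda>(c, f). pCons c f) ` (UNIV \<times> monics n)"
    using g by auto
qed (auto simp: monics_def)

lemma finite_card_monics:
  "finite (monics n :: 'a :: {finite, field} poly set) \<and> card (monics n :: 'a poly set) = card (UNIV :: 'a set) ^ n"
proof (induction n)
  case 0
  show ?case
    by (simp add: monics_0)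
next
  case (Suc n)
  have "inj (\<lambda>(c, f). pCons c f :: 'a poly)"
    by (auto simp: inj_def)
  hence "card (monics (Suc n) :: 'a poly set) = card ((UNIV :: 'a set) \<times> (monics n :: 'a poly set))"
    unfolding monics_Suc by (rule card_image[OF inj_on_subset[OF _ subset_UNIV]])
  with Suc show ?case
    by (simp add: card_cartesian_product monics_Suc)
qed

lemmas finite_monics [simp] = conjunct1[OF finite_card_monics]
lemmas card_monics = conjunct2[OF finite_card_monics]

lemma finite_monic_irreducibles [simp]:
  "finite (monic_irreducibles n :: 'a :: {finite, field} poly set)"
  by (rule finite_subset[OF _ finite_monics[of n]]) (auto simp: monic_irreducibles_def monics_def)

lemma monic_irreducibles_pos: "p \<in> monic_irreducibles n \<Longrightarrow> 0 < n"
  by (auto simp: monic_irreducibles_def irreducible_def is_unit_iff_degree)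

section \<open>Gauss's formula for the number of monic irreducible polynomials\<close>

lemma card_monics_multiples:
  fixes g :: "'a :: {finite, field} poly"
  assumes "lead_coeff g = 1"
  shows "card {f \<in> monics n. g dvd f} = (if degree g \<le> n then card (UNIV :: 'a set) ^ (n - degree g) else 0)"
proof -
  have g0: "g \<noteq> 0"
    using assms by auto
  show ?thesis
  proof (cases "degree g \<le> n")
    case True
    have deg: "degree (g * h) = degree g + degree h" if "h \<noteq> 0" for h
      using g0 that by (rule degree_mult_eq)
    have lc: "lead_coeff (g * h) = lead_coeff h" for h
      using assms by (simp only: lead_coeff_mult mult_1_left)
    have *: "g * h \<in> monics n \<longleftrightarrow> h \<in> monics (n - degree g)" for h
    proof (cases "h = 0")
      case False
      show ?thesis
        unfolding monics_def mem_Collect_eq lc using deg[OF False] True by auto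
    qed (auto simp: monics_def)
    \<comment> \<open>Multiples of the monic \<open>g\<close> are counted by their cofactors, which
      are arbitrary monic polynomials of the remaining degree.\<close>
    have "{f \<in> monics n. g dvd f} = (*) g ` monics (n - degree g)"
    proof (intro Set.set_eqI iffI)
      fix f assume "f \<in> {f \<in> monics n. g dvd f}"
      then obtain h where "f = g * h" "g * h \<in> monics n"
        by auto
      thus "f \<in> (*) g ` monics (n - degree g)"
        by (metis * image_eqI)
    next
      fix f assume "f \<in> (*) g ` monics (n - degree g)"
      thus "f \<in> {f \<in> monics n. g dvd f}"
        by (auto simp: *)
    qed
    moreover have "inj_on ((*) g) (monics (n - degree g))"
      using g0 by (auto simp: inj_on_def)
    ultimately show ?thesis
      using True by (simp add: card_image card_monics)
  next
    case False
    have "{f \<in> monics n. g dvd f} = {}"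
    proof safe
      fix f assume "f \<in> monics n" "g dvd f"
      moreover from this have "f \<noteq> 0"
        by (auto simp: monics_def)
      ultimately have "degree g \<le> n"
        using dvd_imp_degree_le[of g f] by (auto simp: monics_def)
      thus "f \<in> {}"
        using False by simp
    qed
    with False show ?thesis
      by simp
  qed
qed

lemma monic_irreducible_divisor_exists:
  fixes f :: "'a :: field poly"
  assumes "degree f > 0"
  shows "\<exists>p. lead_coeff p = 1 \<and> irreducible p \<and> p dvd f"
  using assms
proof (induction "degree f" arbitrary: f rule: less_induct)
  case (less f)
  from less.prems have "f \<noteq> 0"
    by auto
  with less.prems have f: "f \<noteq> 0" "\<not> is_unit f"
    by (simp_all add: is_unit_iff_degree)
  show ?case
  proof (cases "irreducible f")
    case True
    define c where "c = inverse (lead_coeff f)"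
    have c: "c \<noteq> 0"
      using f by (simp add: c_def)
    have "lead_coeff (smult c f) = 1"
      using f by (simp add: c_def)
    moreover have "irreducible (smult c f)"
      using True c irreducible_mult_unit_left[of "[:c:]" f] by (simp add: is_unit_const_poly_iff dvd_field_iff)
    moreover have "smult c f dvd f"
      using c by (simp add: smult_dvd_iff)
    ultimately show ?thesis
      by blast
  next
    case False
    then obtain a b where ab: "f = a * b" "\<not> is_unit a" "\<not> is_unit b"
      using f by (auto simp: irreducible_def)
    hence nz: "a \<noteq> 0" "b \<noteq> 0"
      using f by auto
    hence "degree a > 0" "degree b > 0"
      using ab by (auto simp: is_unit_iff_degree)
    hence "degree a < degree f" "degree a > 0"
      using ab(1) nz by (auto simp: degree_mult_eq)
    then obtain p where "lead_coeff p = 1 \<and> irreducible p \<and> p dvd a"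
      using less by blast
    with ab show ?thesis
      by (metis dvd_mult2)
  qed
qed

text \<open>After cancelling \<open>p ^ k\<close> from \<open>g\<close>, the next factor
  \<open>p\<close> must divide the cofactor by primality. Hence splitting off a factor prime to
  \<open>p\<close> does not affect the exponent of \<open>p\<close>.\<close>

lemma prime_elem_power_dvd_mult_other:
  fixes p :: "'a :: idom"
  assumes "prime_elem p" "\<not> p dvd q"
  shows "p ^ k dvd q * g \<longleftrightarrow> p ^ k dvd g"
proof
  show "p ^ k dvd g" if "p ^ k dvd q * g"
    using that
  proof (induction k)
    case (Suc k)
    hence "p ^ k dvd g"
      using power_le_dvd[OF Suc.prems, of k] by simp
    then obtain h where h: "g = p ^ k * h" ..
    have "p ^ k * p dvd p ^ k * (q * h)"
      using Suc.prems h by (simp add: mult_ac)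
    hence "p dvd q * h"
      using assms(1) by (auto simp: prime_elem_def)
    hence "p dvd h"
      using assms by (simp add: prime_elem_dvd_mult_iff)
    thus ?case
      using h by (simp add: mult.commute)
  qed simp
qed simp

text \<open>
  The cardinality is the multiplicity of \<open>p\<close> in \<open>f\<close>; the constant \<open>multiplicity\<close> is not available for
  polynomials over a type that is only known to be in class \<open>field\<close>.
\<close>
lemma degree_eq_sum_irreducible_powers:
  fixes f :: "'a :: {finite, field} poly"
  assumes "lead_coeff f = 1" "degree f \<le> n"
  shows "degree f = (\<Sum>d\<in>{1..n}. \<Sum>p\<in>monic_irreducibles d. d * card {k\<in>{1..n}. p ^ k dvd f})"
  using assms
proof (induction "degree f" arbitrary: f rule: less_induct)
  case less
  show ?case
  proof (cases "degree f = 0")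
    case True
    hence "f = 1"
      using less.prems by (auto elim!: degree_eq_zeroE)
    moreover have "{k\<in>{1..n}. p ^ k dvd 1} = {}" if "p \<in> monic_irreducibles d" for p :: "'a poly" and d
      using that by (auto simp: monic_irreducibles_def irreducible_def is_unit_power_iff)
    ultimately show ?thesis
      by simp
  next
    case False
    then obtain Q where Q: "lead_coeff Q = 1" "irreducible Q" "Q dvd f"
      using monic_irreducible_divisor_exists[of f] by auto
    then obtain g where g: "f = Q * g"
      by auto
    define e where "e = degree Q"
    have Qe: "Q \<in> monic_irreducibles e"
      using Q by (simp add: monic_irreducibles_def e_def)
    have Q_iff: "Q \<in> monic_irreducibles d \<longleftrightarrow> d = e" for d
      using Q by (auto simp: monic_irreducibles_def e_def)
    have e: "e > 0"
      by (rule monic_irreducibles_pos[OF Qe])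
    have nz: "Q \<noteq> 0" "g \<noteq> 0"
      using less.prems g by auto
    have deg: "degree f = e + degree g"
      using nz g by (simp add: degree_mult_eq e_def)
    have lg: "lead_coeff g = 1"
      using less.prems(1) g Q by (simp add: lead_coeff_mult)
    have IH: "degree g = (\<Sum>d\<in>{1..n}. \<Sum>p\<in>monic_irreducibles d. d * card {k\<in>{1..n}. p ^ k dvd g})"
      by (rule less.hyps) (use deg e lg less.prems(2) in linarith)+
    \<comment> \<open>Passing from \<open>g\<close> to \<open>Q * g\<close> raises the exponent of
      \<open>Q\<close> by one and leaves those of the other irreducibles alone.\<close>
    have card: "card {k\<in>{1..n}. p ^ k dvd f} = card {k\<in>{1..n}. p ^ k dvd g} + (if p = Q then 1 else 0)"
      if p: "p \<in> monic_irreducibles d" for p d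
    proof (cases "p = Q")
      case True
      \<comment> \<open>This bound keeps \<open>Suc k\<close> inside \<open>{1..n}\<close>:
        \<open>k \<le> degree g < degree f \<le> n\<close>.\<close>
      have le: "k < n" if "Q ^ k dvd g" for k
      proof -
        have "k * e \<le> degree g"
          using dvd_imp_degree_le[OF that nz(2)] nz by (simp add: degree_power_eq e_def)
        hence "k \<le> degree g"
          using e by (metis le_trans mult_le_mono2 nat_mult_1_right Suc_leI One_nat_def)
        thus ?thesis
          using deg e less.prems by simp
      qed
      have "{k\<in>{1..n}. Q ^ k dvd f} = insert 1 (Suc ` {k\<in>{1..n}. Q ^ k dvd g})"
      proof (intro Set.set_eqI iffI)
        fix k assume k: "k \<in> {k\<in>{1..n}. Q ^ k dvd f}"
        then obtain l where l: "k = Suc l"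
          by (cases k) auto
        hence "Q ^ l dvd g"
          using k nz by (simp add: g)
        thus "k \<in> insert 1 (Suc ` {k\<in>{1..n}. Q ^ k dvd g})"
          using k l by (cases "l = 0") auto
      next
        fix k assume "k \<in> insert 1 (Suc ` {k\<in>{1..n}. Q ^ k dvd g})"
        moreover have "n \<ge> 1"
          using deg e less.prems by simp
        ultimately show "k \<in> {k\<in>{1..n}. Q ^ k dvd f}"
          using le by (auto simp: g Suc_le_eq)
      qed
      also have "card \<dots> = card {k\<in>{1..n}. Q ^ k dvd g} + 1"
        by (subst card_insert_disjoint) (auto simp: card_image)
      finally show ?thesis
        using True by simp
    next
      case False
      hence "\<not> p dvd Q"
        using monic_irreducible_dvd_imp_eq[of p Q] p Q by (auto simp: monic_irreducibles_def)
      thus ?thesis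
        using False p prime_elem_power_dvd_mult_other[of p Q _ g]
        by (simp add: g monic_irreducibles_def field_poly_irreducible_imp_prime)
    qed
    have "(\<Sum>d\<in>{1..n}. \<Sum>p\<in>monic_irreducibles d. d * card {k\<in>{1..n}. p ^ k dvd f})
        = (\<Sum>d\<in>{1..n}. \<Sum>p\<in>monic_irreducibles d.
             d * card {k\<in>{1..n}. p ^ k dvd g} + (if p = Q then d else 0))"
      by (intro sum.cong refl, subst card) (auto simp: algebra_simps)
    also have "\<dots> = degree g + (\<Sum>d\<in>{1..n}. \<Sum>p\<in>monic_irreducibles d. if p = Q then d else 0)"
      by (simp add: sum.distrib IH)
    also have "(\<Sum>d\<in>{1..n}. \<Sum>p\<in>monic_irreducibles d. if p = Q then d else 0)
        = (\<Sum>d\<in>{1..n}. if d = e then e else 0)"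
      by (intro sum.cong refl) (simp add: Q_iff)
    also have "\<dots> = e"
      using e deg less.prems by simp
    finally show ?thesis
      by (simp add: deg)
  qed
qed

text \<open>Sum of the degrees of all monic polynomials of degree \<open>n\<close>, expanded over their irreducible factors.\<close>
lemma mult_card_UNIV_power_eq_sum:
  "n * card (UNIV :: 'a set) ^ n = (\<Sum>j\<in>{1..n}. card (UNIV :: 'a set) ^ (n - j) *
     (\<Sum>d | d dvd j. d * card (monic_irreducibles d :: 'a :: {finite, field} poly set)))"
proof -
  let ?q = "card (UNIV :: 'a set)" and ?I = "\<lambda>d. monic_irreducibles d :: 'a poly set"
  let ?M = "monics n :: 'a poly set"
  have "n * ?q ^ n = (\<Sum>f\<in>?M. n)"
    by (simp add: card_monics)
  also have "\<dots> = (\<Sum>f\<in>?M. \<Sum>d\<in>{1..n}. \<Sum>p\<in>?I d. d * card {k\<in>{1..n}. p ^ k dvd f})"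
  proof (intro sum.cong refl)
    fix f assume "f \<in> ?M"
    hence f: "lead_coeff f = 1" "degree f = n"
      by (auto simp: monics_def)
    show "n = (\<Sum>d\<in>{1..n}. \<Sum>p\<in>?I d. d * card {k\<in>{1..n}. p ^ k dvd f})"
      using degree_eq_sum_irreducible_powers[OF f(1), of n] unfolding f(2) by simp
  qed
  also have "\<dots> = (\<Sum>d\<in>{1..n}. \<Sum>p\<in>?I d. \<Sum>f\<in>?M. d * card {k\<in>{1..n}. p ^ k dvd f})"
    by (subst sum.swap, subst (2) sum.swap) (rule refl)
  \<comment> \<open>Double counting of the pairs \<open>(k, f)\<close> for which
    \<open>p ^ k\<close> divides \<open>f\<close>.\<close>
  also have "\<dots> = (\<Sum>d\<in>{1..n}. \<Sum>p\<in>?I d. \<Sum>k\<in>{1..n}. d * card {f\<in>?M. p ^ k dvd f})"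
  proof (intro sum.cong refl)
    fix d and p :: "'a poly"
    have "(\<Sum>f\<in>?M. d * card {k\<in>{1..n}. p ^ k dvd f}) = d * (\<Sum>f\<in>?M. \<Sum>k\<in>{1..n}. if p ^ k dvd f then 1 else 0)"
      by (simp add: sum_distrib_left sum.If_cases Int_def conj_commute)
    also have "\<dots> = d * (\<Sum>k\<in>{1..n}. \<Sum>f\<in>?M. if p ^ k dvd f then 1 else 0)"
      by (subst sum.swap) (rule refl)
    also have "\<dots> = (\<Sum>k\<in>{1..n}. d * card {f\<in>?M. p ^ k dvd f})"
      by (simp add: sum_distrib_left sum.If_cases Int_def conj_commute)
    finally show "(\<Sum>f\<in>?M. d * card {k\<in>{1..n}. p ^ k dvd f}) = (\<Sum>k\<in>{1..n}. d * card {f\<in>?M. p ^ k dvd f})" .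
  qed
  also have "\<dots> = (\<Sum>d\<in>{1..n}. \<Sum>p\<in>?I d. \<Sum>k\<in>{1..n}. d * (if k * d \<le> n then ?q ^ (n - k * d) else 0))"
  proof (intro sum.cong refl arg_cong2[where f = "(*)"])
    fix d k and p :: "'a poly"
    assume p: "p \<in> ?I d"
    hence "p \<noteq> 0" "lead_coeff (p ^ k) = 1"
      by (auto simp: monic_irreducibles_def lead_coeff_power)
    thus "card {f\<in>?M. p ^ k dvd f} = (if k * d \<le> n then ?q ^ (n - k * d) else 0)"
      using p by (subst card_monics_multiples) (auto simp: degree_power_eq monic_irreducibles_def)
  qed
  \<comment> \<open>The summand depends on \<open>p\<close> only through \<open>d\<close>, which
    gives the factor \<open>card (?I d)\<close>; the terms are then regrouped by
    \<open>j = k * d\<close>, the degree of \<open>p ^ k\<close>.\<close>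
  also have "\<dots> = (\<Sum>d\<in>{1..n}. \<Sum>k\<in>{1..n}. \<Sum>j\<in>{1..n}. if j = k * d then ?q ^ (n - j) * (d * card (?I d)) else 0)"
    by (simp add: sum_distrib_left) (auto intro!: sum.cong)
  also have "\<dots> = (\<Sum>j\<in>{1..n}. \<Sum>d\<in>{1..n}. \<Sum>k\<in>{1..n}. if j = k * d then ?q ^ (n - j) * (d * card (?I d)) else 0)"
    by (subst (2) sum.swap, subst sum.swap) (rule refl)
  also have "\<dots> = (\<Sum>j\<in>{1..n}. \<Sum>d\<in>{1..n}. if d dvd j then ?q ^ (n - j) * (d * card (?I d)) else 0)"
  proof (intro sum.cong refl)
    fix j d assume j: "j \<in> {1..n}" and d: "d \<in> {1..n}"
    show "(\<Sum>k\<in>{1..n}. if j = k * d then ?q ^ (n - j) * (d * card (?I d)) else 0)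
        = (if d dvd j then ?q ^ (n - j) * (d * card (?I d)) else 0)"
    proof (cases "d dvd j")
      case True
      then obtain l where l: "j = l * d"
        by (metis dvdE mult.commute)
      have "l \<le> l * d"
        using d by simp
      hence "l \<le> n"
        using j l by (metis atLeastAtMost_iff le_trans)
      hence "l \<in> {1..n}"
        using j l by (cases "l = 0") auto
      moreover have "j = k * d \<longleftrightarrow> k = l" for k
        using l d by auto
      ultimately show ?thesis
        using True by simp
    qed auto
  qed
  also have "\<dots> = (\<Sum>j\<in>{1..n}. \<Sum>d | d dvd j. ?q ^ (n - j) * (d * card (?I d)))"
  proof (rule sum.cong[OF refl])
    fix j assume j: "j \<in> {1..n}"
    have "d \<in> {1..n}" if "d dvd j" for d
      using dvd_imp_le[OF that] dvd_pos_nat[OF _ that] j by auto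
    hence "{d\<in>{1..n}. d dvd j} = {d. d dvd j}"
      by blast
    thus "(\<Sum>d\<in>{1..n}. if d dvd j then ?q ^ (n - j) * (d * card (?I d)) else 0)
        = (\<Sum>d | d dvd j. ?q ^ (n - j) * (d * card (?I d)))"
      by (subst sum.inter_filter [symmetric]) auto
  qed
  finally show ?thesis
    by (simp add: sum_distrib_left)
qed

text \<open>In the preceding identity the terms with \<open>j < n\<close> form \<open>q\<close>
  times the identity for \<open>n - 1\<close>. Subtracting leaves
  \<open>n * q ^ n - (n - 1) * q ^ n = q ^ n\<close> for the term \<open>j = n\<close>.\<close>

lemma sum_divisors_card_monic_irreducibles:
  assumes "n > 0"
  shows "(\<Sum>d | d dvd n. d * card (monic_irreducibles d :: 'a :: {finite, field} poly set)) = card (UNIV :: 'a set) ^ n"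
proof -
  define A where "A = (\<lambda>n. \<Sum>d | d dvd n. d * card (monic_irreducibles d :: 'a poly set))"
  let ?q = "card (UNIV :: 'a set)"
  obtain k where k: "n = Suc k"
    using assms by (cases n) auto
  have "n * ?q ^ n = (\<Sum>j\<in>{1..n}. ?q ^ (n - j) * A j)"
    unfolding A_def by (rule mult_card_UNIV_power_eq_sum)
  also have "\<dots> = (\<Sum>j\<in>{1..k}. ?q ^ (n - j) * A j) + A n"
    by (simp add: k)
  also have "(\<Sum>j\<in>{1..k}. ?q ^ (n - j) * A j) = ?q * (\<Sum>j\<in>{1..k}. ?q ^ (k - j) * A j)"
    unfolding sum_distrib_left by (intro sum.cong refl) (simp add: k Suc_diff_le)
  also have "(\<Sum>j\<in>{1..k}. ?q ^ (k - j) * A j) = k * ?q ^ k"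
    unfolding A_def by (rule mult_card_UNIV_power_eq_sum [symmetric])
  finally show ?thesis
    by (simp add: k A_def)
qed

section \<open>Irreducible polynomials of degree an odd prime times a power of two\<close>

lemma divisors_prime_mult_two_power:
  fixes p :: nat
  assumes "prime p" "odd p"
  shows "{d. d dvd p * 2 ^ s} = {d. d dvd 2 ^ s} \<union> (\<lambda>i. p * 2 ^ i) ` {..s}"
proof (intro Set.set_eqI iffI)
  fix d assume d: "d \<in> {d. d dvd p * 2 ^ s}"
  show "d \<in> {d. d dvd 2 ^ s} \<union> (\<lambda>i. p * 2 ^ i) ` {..s}"
  proof (cases "p dvd d")
    case True
    then obtain e where e: "d = p * e" ..
    with d assms have "e dvd 2 ^ s"
      by auto
    then obtain i where "i \<le> s" "e = 2 ^ i"
      by (auto simp: divides_primepow_nat)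
    with e show ?thesis
      by auto
  next
    case False
    hence "coprime d p"
      using assms(1) by (metis coprime_commute prime_imp_coprime)
    with d show ?thesis
      by (simp add: coprime_dvd_mult_right_iff)
  qed
qed (auto intro: mult_dvd_mono le_imp_power_dvd)

text \<open>Gauss's formula with the divisors sorted by divisibility by \<open>p\<close>: those
  prime to \<open>p\<close> are the divisors of \<open>2 ^ s\<close>, and the same formula evaluates
  their contribution.\<close>

lemma sum_card_monic_irreducibles_two_adic:
  assumes "prime p" "odd p"
  shows "(\<Sum>i\<le>s. p * 2 ^ i * card (monic_irreducibles (p * 2 ^ i) :: 'a :: {finite, field} poly set))
           + card (UNIV :: 'a set) ^ 2 ^ s = card (UNIV :: 'a set) ^ (p * 2 ^ s)"
proof -
  let ?g = "\<lambda>d. d * card (monic_irreducibles d :: 'a poly set)"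
  have p: "p > 1" "p > 0"
    using prime_gt_1_nat[OF assms(1)] by auto
  have "\<not> p * 2 ^ i dvd 2 ^ s" for i
  proof
    assume "p * 2 ^ i dvd 2 ^ s"
    hence "p dvd 2 ^ s"
      by (rule dvd_mult_left)
    hence "p dvd 2"
      using assms(1) prime_dvd_power by blast
    with assms show False
      by (metis primes_dvd_imp_eq two_is_prime_nat even_numeral)
  qed
  hence disj: "{d. d dvd 2 ^ s} \<inter> (\<lambda>i. p * 2 ^ i) ` {..s} = {}"
    by auto
  have "card (UNIV :: 'a set) ^ (p * 2 ^ s) = sum ?g {d. d dvd p * 2 ^ s}"
    by (rule sum_divisors_card_monic_irreducibles [symmetric]) (use p in simp)
  also have "\<dots> = sum ?g {d. d dvd 2 ^ s} + sum ?g ((\<lambda>i. p * 2 ^ i) ` {..s})"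
    unfolding divisors_prime_mult_two_power[OF assms]
    by (rule sum.union_disjoint) (use disj in auto)
  also have "sum ?g {d. d dvd 2 ^ s} = card (UNIV :: 'a set) ^ 2 ^ s"
    by (rule sum_divisors_card_monic_irreducibles) simp
  also have "sum ?g ((\<lambda>i. p * 2 ^ i) ` {..s}) = (\<Sum>i\<le>s. ?g (p * 2 ^ i))"
    by (rule sum.reindex_cong[of "\<lambda>i. p * 2 ^ i"]) (use p in \<open>auto simp: inj_on_def\<close>)
  finally show ?thesis
    by simp
qed

text \<open>In the binomial expansion every term beyond the linear one contains
  \<open>x ^ 2\<close>, hence \<open>p ^ 2\<close>.\<close>

lemma dvd_power_minus_linear:
  fixes x p :: "'a :: comm_ring_1"
  assumes "p dvd x"
  shows "p ^ 2 dvd (1 + x) ^ k - (1 + of_nat k * x)"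
proof (induction k)
  case (Suc k)
  have "p ^ 2 dvd x ^ 2"
    using assms by (rule dvd_power_same)
  hence "p ^ 2 dvd (1 + x) * ((1 + x) ^ k - (1 + of_nat k * x)) + of_nat k * x ^ 2"
    using Suc by (intro dvd_add dvd_mult)
  thus ?case
    by (simp add: algebra_simps power2_eq_square)
qed simp

text \<open>
  With \<open>q = 1 + x\<close> and \<open>T n = q ^ (p * n) - q ^ n\<close>, Moebius inversion over the powers of two gives
  \<open>p * 2 ^ s * N = T (2 ^ s) - T (2 ^ (s - 1))\<close>, while \<open>T n\<close> is congruent to \<open>- n * x\<close> modulo \<open>p ^ 2\<close>.
\<close>
lemma prime_not_dvd_card_monic_irreducibles:
  assumes p: "prime p" "odd p" and dvd: "p dvd card (UNIV :: 'a set) - 1" and ndvd: "\<not> p ^ 2 dvd card (UNIV :: 'a set) - 1"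
  shows "\<not> p dvd card (monic_irreducibles (p * 2 ^ s) :: 'a :: {finite, field} poly set)"
proof
  let ?N = "\<lambda>i. card (monic_irreducibles (p * 2 ^ i) :: 'a poly set)"
  assume *: "p dvd ?N s"
  define x where "x = int (card (UNIV :: 'a set) - 1)"
  have q: "int (card (UNIV :: 'a set)) = 1 + x"
    by (simp add: x_def of_nat_diff Suc_leI finite_UNIV_card_ge_0)
  have px: "int p dvd x"
    using dvd unfolding x_def by (simp only: of_nat_dvd_iff)
  have npx: "\<not> int p ^ 2 dvd x"
    using ndvd unfolding x_def by (metis of_nat_dvd_iff of_nat_power)
  define T where "T = (\<lambda>n. (1 + x) ^ (p * n) - (1 + x) ^ n)"
  \<comment> \<open>Modulo \<open>p ^ 2\<close> the first power in \<open>T n\<close> is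
    \<open>1 + p * n * x\<close>, which is 1 as \<open>p\<close> divides \<open>x\<close>, and the
    second is \<open>1 + n * x\<close>.\<close>
  have T: "int p ^ 2 dvd T n + int n * x" for n
  proof -
    have "int p ^ 2 dvd int p * x"
      using px by (simp add: power2_eq_square mult_dvd_mono)
    hence "int p ^ 2 dvd ((1 + x) ^ (p * n) - (1 + int (p * n) * x)) -
             ((1 + x) ^ n - (1 + int n * x)) + int n * (int p * x)"
      by (rule dvd_add[OF dvd_diff[OF dvd_power_minus_linear[OF px] dvd_power_minus_linear[OF px]] dvd_mult])
    thus ?thesis
      by (simp add: T_def algebra_simps)
  qed
  have sumT: "(\<Sum>i\<le>r. int (p * 2 ^ i * ?N i)) = T (2 ^ r)" for r
  proof -
    have "int ((\<Sum>i\<le>r. p * 2 ^ i * ?N i) + card (UNIV :: 'a set) ^ 2 ^ r) = int (card (UNIV :: 'a set) ^ (p * 2 ^ r))"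
      by (subst sum_card_monic_irreducibles_two_adic[OF p]) (rule refl)
    thus ?thesis
      by (simp add: T_def q)
  qed
  have pN: "int p ^ 2 dvd int (p * 2 ^ s * ?N s)"
    using * by (metis dvd_triv_left mult_dvd_mono dvd_mult2 of_nat_dvd_iff of_nat_power power2_eq_square)
  show False
  proof (cases s)
    \<comment> \<open>There is no smaller power of two to subtract here: \<open>T 1\<close> is
      already \<open>p\<close> times the count.\<close>
    case 0
    have "int p ^ 2 dvd T 1"
      using sumT[of 0] pN 0 by simp
    from dvd_diff[OF T[of 1] this] show False
      using npx by simp
  next
    case (Suc r)
    have "T (2 ^ s) = T (2 ^ r) + int (p * 2 ^ s * ?N s)"
      unfolding sumT [symmetric] Suc by simp
    hence "int p ^ 2 dvd T (2 ^ s) - T (2 ^ r)"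
      using pN by simp
    \<comment> \<open>The linear terms differ by \<open>(2 ^ s - 2 ^ r) * x = 2 ^ r * x\<close>, and
      the power of two is prime to the odd \<open>p\<close>.\<close>
    from dvd_diff[OF dvd_diff[OF T[of "2 ^ s"] T[of "2 ^ r"]] this]
    have "int p ^ 2 dvd 2 ^ r * x"
      by (simp add: Suc algebra_simps)
    moreover have "coprime (int p ^ 2) (2 ^ r)"
      using p by simp
    ultimately show False
      using npx by (simp add: coprime_dvd_mult_right_iff)
  qed
qed

lemma card_monic_irreducibles_1: "card (monic_irreducibles 1 :: 'a :: {finite, field} poly set) = card (UNIV :: 'a set)"
  using sum_divisors_card_monic_irreducibles[of 1, where ?'a = 'a] by simp

section \<open>Factorization types with distinct parts\<close>

text \<open>When the parts are distinct, a polynomial of this type amounts to one independent choice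
  of a monic irreducible per degree. The choices are recovered from the product by unique
  factorization, since the degree tells which factor is which.\<close>

lemma S_fact_type_distinct_degrees:
  assumes D: "finite D"
  shows "bij_betw (\<lambda>g. \<Prod>d\<in>D. g d) (PiE D monic_irreducibles) (S_fact_type (mset_set D) :: 'a :: field poly set)"
  unfolding bij_betw_def
proof
  let ?I = "monic_irreducibles :: nat \<Rightarrow> 'a poly set"
  show "inj_on (\<lambda>g. \<Prod>d\<in>D. g d) (PiE D ?I)"
  proof (rule inj_onI)
    fix g h assume g: "g \<in> PiE D ?I" and h: "h \<in> PiE D ?I" and eq: "(\<Prod>d\<in>D. g d) = (\<Prod>d\<in>D. h d)"
    show "g = h"
    proof (rule PiE_ext[OF g h])
      fix d assume d: "d \<in> D"
      have gd: "g d \<in> ?I d"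
        using g d by auto
      have "g d dvd (\<Prod>d\<in>D. h d)"
        unfolding eq [symmetric] using D d by (rule dvd_prodI)
      moreover have "prime_elem (g d)"
        using gd by (simp add: monic_irreducibles_def field_poly_irreducible_imp_prime)
      ultimately obtain e where e: "e \<in> D" "g d dvd h e"
        using prime_elem_dvd_prodD[of "g d" D h] D by blast
      have he: "h e \<in> ?I e"
        using h e by auto
      have "g d = h e"
        by (rule monic_irreducible_dvd_imp_eq) (use gd he e in \<open>auto simp: monic_irreducibles_def\<close>)
      moreover from this have "d = e"
        using gd he by (auto simp: monic_irreducibles_def)
      ultimately show "g d = h d"
        by simp
    qed
  qed
  show "(\<lambda>g. \<Prod>d\<in>D. g d) ` PiE D ?I = S_fact_type (mset_set D)"
  proof (intro Set.set_eqI iffI)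
    fix f assume "f \<in> (\<lambda>g. \<Prod>d\<in>D. g d) ` PiE D ?I"
    then obtain g where g: "g \<in> PiE D ?I" and f: "f = (\<Prod>d\<in>D. g d)"
      by auto
    have gI: "lead_coeff (g d) = 1" "irreducible (g d)" "degree (g d) = d" if "d \<in> D" for d
      using g that by (auto simp: monic_irreducibles_def dest!: PiE_mem)
    have inj: "inj_on g D"
      using gI(3) by (metis inj_onI)
    have "lead_coeff f = 1"
      unfolding f lead_coeff_prod using gI(1) by simp
    moreover have "f = \<Prod>(g ` D)"
      unfolding f using inj by (simp add: prod.reindex)
    moreover have "image_mset degree (mset_set (g ` D)) = mset_set D"
    proof -
      have "image_mset degree (mset_set (g ` D)) = image_mset degree (image_mset g (mset_set D))"
        using inj by (simp add: image_mset_mset_set)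
      also have "\<dots> = image_mset (\<lambda>d. d) (mset_set D)"
        unfolding multiset.map_comp by (rule image_mset_cong) (use D gI in auto)
      finally show ?thesis
        by simp
    qed
    moreover have "finite (g ` D)" "\<forall>p\<in>g ` D. lead_coeff p = 1 \<and> irreducible p"
      using D gI(1,2) by blast+
    ultimately show "f \<in> S_fact_type (mset_set D)"
      unfolding S_fact_type_def by blast
  next
    fix f :: "'a poly" assume "f \<in> S_fact_type (mset_set D)"
    then obtain P where P: "finite P" "\<And>p. p \<in> P \<Longrightarrow> lead_coeff p = 1 \<and> irreducible p" "f = \<Prod>P"
        "image_mset degree (mset_set P) = mset_set D"
      unfolding S_fact_type_def by blast
    have deg: "degree ` P = D"
      using arg_cong[OF P(4), of set_mset] P(1) D by simp
    \<comment> \<open>The degrees of \<open>P\<close> fill \<open>D\<close> and the sizes agree, so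
      no degree occurs twice.\<close>
    have "card P = card D"
      using arg_cong[OF P(4), of size] by simp
    hence inj: "inj_on degree P"
      using P(1) deg by (simp add: eq_card_imp_inj_on)
    \<comment> \<open>The function picks the factor of degree \<open>d\<close>;
      \<open>restrict\<close> makes it extensional, as membership in \<open>PiE\<close>
      demands.\<close>
    define g where "g = restrict (inv_into P degree) D"
    have "bij_betw (inv_into P degree) D P"
      using inj deg by (intro bij_betw_inv_into) (simp add: bij_betw_def)
    from prod.reindex_bij_betw[OF this, of "\<lambda>p. p"]
    have "f = (\<Prod>d\<in>D. g d)"
      by (simp add: P(3) g_def)
    moreover have "inv_into P degree d \<in> ?I d" if "d \<in> D" for d
      using that P(2) unfolding deg [symmetric]
      by (auto simp: monic_irreducibles_def inv_into_into f_inv_into_f inj)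
    hence "g \<in> PiE D ?I"
      by (auto simp: g_def)
    ultimately show "f \<in> (\<lambda>g. \<Prod>d\<in>D. g d) ` PiE D ?I"
      by blast
  qed
qed

text \<open>Shifting all exponents doubles the sum, and adjoining exponent 0 adds one. Having the
  exponents in a set is what makes the resulting parts distinct.\<close>

lemma binary_expansion_nat: "\<exists>I. finite I \<and> (\<Sum>i\<in>I. 2 ^ i) = (n :: nat)"
proof (induction n rule: nat_bit_induct)
  case zero
  show ?case
    by (rule exI[of _ "{}"]) simp
next
  case (even n)
  then obtain I where I: "finite I" "(\<Sum>i\<in>I. 2 ^ i) = n"
    by blast
  have "(\<Sum>i\<in>Suc ` I. 2 ^ i) = 2 * n"
    by (simp add: sum.reindex I(2) flip: sum_distrib_left)
  with I(1) show ?case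
    by (intro exI[of _ "Suc ` I"]) simp
next
  case (odd n)
  then obtain I where I: "finite I" "(\<Sum>i\<in>I. 2 ^ i) = n"
    by blast
  have "(\<Sum>i\<in>Suc ` I. 2 ^ i) = 2 * n"
    by (simp add: sum.reindex I(2) flip: sum_distrib_left)
  with I(1) show ?case
    by (intro exI[of _ "insert 0 (Suc ` I)"]) simp
qed

section \<open>Equidistribution against a type whose count is prime to \<open>p\<close>\<close>

theorem theorem5p3:
  fixes q m :: nat
  assumes "card (UNIV :: 'a set) = q"
    and "\<exists>k. q = 2 ^ k"
    and "squarefree (q - 1)"
    and "m \<ge> 2"
    and "\<forall>lam. is_partition lam m \<longrightarrow>
           (\<exists>c. \<forall>a::'a::{finite,field}. a \<noteq> 0 \<longrightarrow> card {f \<in> (S_fact_type lam :: 'a poly set). disc f = a} = c)"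
  shows "gcd (q - 1) (m * (m - 1)) = 1"
proof (rule ccontr)
  assume "gcd (q - 1) (m * (m - 1)) \<noteq> 1"
  then obtain p where p: "prime p" and "p dvd gcd (q - 1) (m * (m - 1))"
    using prime_factor_nat by blast
  hence pq: "p dvd q - 1" and pm: "p dvd m \<or> p dvd m - 1"
    by (auto simp: prime_dvd_mult_iff)
  obtain k where k: "q = 2 ^ k"
    using assms(2) by blast
  have "q \<ge> 2"
    using card_mono[of "UNIV :: 'a set" "{0, 1}"] assms(1) by simp
  hence "even q" "q > 0"
    using k by (cases k; simp)+
  hence "odd (q - 1)"
    by simp
  hence odd: "odd p"
    using pq dvd_trans by blast
  \<comment> \<open>Otherwise squarefreeness of \<open>q - 1\<close> would make the prime
    \<open>p\<close> a unit.\<close>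
  have npq: "\<not> p ^ 2 dvd q - 1"
    using squarefreeD[OF assms(3), of p] p by auto
  obtain e n where m: "m = p * n + e" and e: "e \<in> {0, 1}"
  proof (cases "p dvd m")
    case True
    then obtain n where "m = p * n" ..
    thus ?thesis
      using that[of n 0] by simp
  next
    case False
    then obtain n where "m - 1 = p * n"
      using pm by auto
    hence "m = p * n + 1"
      using assms(4) by simp
    thus ?thesis
      using that[of n 1] by simp
  qed
  obtain I where I: "finite I" "(\<Sum>i\<in>I. 2 ^ i) = n"
    using binary_expansion_nat by blast
  define B where "B = (\<lambda>i. p * 2 ^ i) ` I"
  \<comment> \<open>The interval \<open>{1..e}\<close> is empty for \<open>e = 0\<close> and
    \<open>{1}\<close> for \<open>e = 1\<close>; it misses \<open>B\<close>, whose elements are at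
    least \<open>p\<close>.\<close>
  define D where "D = {1..e} \<union> B"
  have p1: "p > 1"
    using p prime_gt_1_nat by blast
  have fin: "finite D"
    by (simp add: D_def B_def I(1))
  have disj: "{1..e} \<inter> B = {}"
    using e p1 by (auto simp: B_def)
  have "\<Sum>{1..e} = e"
    using e by auto
  moreover have "\<Sum>B = p * n"
  proof -
    have "\<Sum>B = (\<Sum>i\<in>I. p * 2 ^ i)"
      unfolding B_def by (rule sum.reindex_cong[of "\<lambda>i. p * 2 ^ i"]) (use p1 in \<open>auto simp: inj_on_def\<close>)
    thus ?thesis
      by (simp add: I(2) flip: sum_distrib_left)
  qed
  ultimately have "\<Sum>D = m"
    using disj by (simp add: D_def m B_def I(1) sum.union_disjoint)
  moreover have "\<forall>d\<in>D. 0 < d"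
    using p1 by (auto simp: D_def B_def)
  ultimately have part: "is_partition (mset_set D) m"
    using fin by (simp add: is_partition_def sum_unfold_sum_mset)
  let ?S = "S_fact_type (mset_set D) :: 'a poly set"
  let ?N = "\<lambda>d. card (monic_irreducibles d :: 'a poly set)"
  have bij: "bij_betw (\<lambda>g. \<Prod>d\<in>D. g d) (PiE D monic_irreducibles) ?S"
    by (rule S_fact_type_distinct_degrees[OF fin])
  hence finS: "finite ?S"
    using bij_betw_finite fin by (metis finite_PiE finite_monic_irreducibles)
  have "card ?S = (\<Prod>d\<in>D. ?N d)"
    using bij_betw_same_card[OF bij] fin by (simp add: card_PiE)
  moreover have "\<not> p dvd ?N d" if "d \<in> D" for d
  proof (cases "d \<in> B")
    case True
    thus ?thesis
      using prime_not_dvd_card_monic_irreducibles[OF p odd, where ?'a = 'a] pq npq assms(1)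
      by (auto simp: B_def)
  next
    case False
    \<comment> \<open>Here \<open>d\<close> is the single part 1, and the prime \<open>p\<close>
      dividing \<open>q - 1\<close> cannot divide \<open>q\<close>.\<close>
    hence "?N d = q"
      using that e card_monic_irreducibles_1[where ?'a = 'a] assms(1) by (auto simp: D_def)
    moreover have "\<not> p dvd q"
    proof
      assume "p dvd q"
      hence "p dvd q - (q - 1)"
        using pq by (rule dvd_diff_nat)
      thus False
        using \<open>q > 0\<close> p1 by simp
    qed
    ultimately show ?thesis
      by simp
  qed
  ultimately have "\<not> p dvd card ?S"
    using fin p by (simp add: prime_dvd_prod_iff)
  moreover obtain c where c: "\<And>a :: 'a. a \<noteq> 0 \<Longrightarrow> card {f \<in> ?S. disc f = a} = c"
    using assms(5) part by meson
  have "disc f \<noteq> 0" if "f \<in> ?S" for f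
    using that by (rule disc_nonzero_if_squarefree[rotated]) (simp add: assms(1) k)
  hence "disc ` ?S \<subseteq> UNIV - {0}"
    by auto
  \<comment> \<open>No discriminant vanishes, so the fibres over the \<open>q - 1\<close> nonzero
    values exhaust \<open>?S\<close>; each has \<open>c\<close> elements, which makes
    \<open>card ?S\<close> a multiple of \<open>q - 1\<close> and hence of \<open>p\<close>.\<close>
  hence "card ?S = (\<Sum>a\<in>UNIV - {0}. card {f \<in> ?S. disc f = a})"
    using sum.group[OF finS, of "UNIV - {0}" disc "\<lambda>_. 1 :: nat"] by simp
  hence "card ?S = (q - 1) * c"
    by (simp add: c assms(1) card_Diff_singleton)
  ultimately show False
    using pq by simp
qed

end
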